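(* Let $k\in\mathbb N$ and let $(T,K)$ be a netblock representation. The following statements are equivalent: (i) $G(T,K)$ is star $k$-choosable; (ii) $G(T,K)$ admits a star $k$-coloring; (iii) $K(e)\le k$ for every $e\in E(T)$, and every maximal $(k-1)$-subtree of $(T,K)$ contains a $(k-1)$-exit vertex of $(T,K)$.
   Context: All graphs are finite and simple. A netblock representation is a pair $(T,K)$ where $T$ is a tree and $K:E(T)\to\mathbb N$ is a weight function. The graph $G(T,K)$ is obtained from $T$ by inserting, for every edge $vw\in E(T)$, a clique $B(vw)$ of $K(vw)$ new vertices, each adjacent to $v$ and $w$ (and to each other). For $c\in\mathbb N$, a $c$-subtree of $(T,K)$ is a subtree of $T$ formed by edges of weight $c$; a maximal $c$-subtree is a $c$-subtree whose edge set is not included in the edge set of another $c$-subtree. A $c$-exit vertex of $(T,K)$ is a vertex $v$ of $T$ having a neighbor $w$ in $T$ with $K(vw)<c$. A star of a graph is a vertex set inducing $K_{1,m}$ ($m\ge1$); maximal stars are stars not properly contained in another star. A $k$-coloring is a map into $\{1,\dots,k\}$; a star $k$-coloring has no monochromatic maximal star. For a $k$-list assignment $L$ ($L(v)\subseteq\mathbb N$, $|L(v)|=k$), an $L$-coloring satisfies $\rho(v)\in L(v)$; the graph is star $k$-choosable if for every $k$-list assignment $L$ there is an $L$-coloring with no monochromatic maximal star.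
   Formalization: One-vertex subtrees count as c-subtrees, with maximality by subtree inclusion, and T must have an edge; as printed (iii) fails to imply (ii): T one edge, K=2, k=2 gives K_4, which has no star 2-coloring, yet (iii) holds vacuously; for one-vertex T the amended (iii) fails. *)

theory Defs
  imports Main
begin

type_synonym 'v graph = "'v set \<times> 'v set set"

abbreviation verts :: "'v graph \<Rightarrow> 'v set" where "verts \<equiv> fst"
abbreviation edges :: "'v graph \<Rightarrow> 'v set set" where "edges \<equiv> snd"

definition simple_graph :: "'v graph \<Rightarrow> bool" where
  "simple_graph G \<longleftrightarrow> finite (verts G) \<and> (\<forall>e\<in>edges G. e \<subseteq> verts G \<and> card e = 2)"

definition connected_graph :: "'v graph \<Rightarrow> bool" where
  "connected_graph G \<longleftrightarrow> verts G \<noteq> {} \<and>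
     (\<forall>u\<in>verts G. \<forall>v\<in>verts G. (u, v) \<in> {(x, y). {x, y} \<in> edges G}\<^sup>*)"

definition is_cycle :: "'v graph \<Rightarrow> 'v list \<Rightarrow> bool" where
  "is_cycle G p \<longleftrightarrow> length p \<ge> 3 \<and> distinct p \<and>
     (\<forall>i<length p. {p ! i, p ! (Suc i mod length p)} \<in> edges G)"

definition tree :: "'v graph \<Rightarrow> bool" where
  "tree G \<longleftrightarrow> simple_graph G \<and> connected_graph G \<and> (\<nexists>p. is_cycle G p)"

definition subgraph :: "'v graph \<Rightarrow> 'v graph \<Rightarrow> bool" where
  "subgraph H G \<longleftrightarrow> verts H \<subseteq> verts G \<and> edges H \<subseteq> edges G"

definition induced :: "'v graph \<Rightarrow> 'v set \<Rightarrow> 'v graph" where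
  "induced G S = (S, {e \<in> edges G. e \<subseteq> S})"

definition isomorphic :: "'v graph \<Rightarrow> 'w graph \<Rightarrow> bool" where
  "isomorphic G H \<longleftrightarrow> (\<exists>f. bij_betw f (verts G) (verts H) \<and> (\<lambda>e. f ` e) ` edges G = edges H)"

text \<open>The complete bipartite graph \<open>K\<^sub>1\<^sub>,\<^sub>m\<close>, with center \<open>0\<close>.\<close>

definition K1 :: "nat \<Rightarrow> nat graph" where
  "K1 m = ({0..m}, {{0, i} | i. i \<in> {1..m}})"

definition star :: "'v graph \<Rightarrow> 'v set \<Rightarrow> bool" where
  "star G S \<longleftrightarrow> S \<subseteq> verts G \<and> (\<exists>m\<ge>1. isomorphic (induced G S) (K1 m))"

definition maximal_star :: "'v graph \<Rightarrow> 'v set \<Rightarrow> bool" where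
  "maximal_star G S \<longleftrightarrow> star G S \<and> (\<nexists>S'. star G S' \<and> S \<subset> S')"

definition monochromatic :: "('v \<Rightarrow> nat) \<Rightarrow> 'v set \<Rightarrow> bool" where
  "monochromatic \<rho> S \<longleftrightarrow> (\<exists>c. \<forall>v\<in>S. \<rho> v = c)"

definition star_coloring :: "'v graph \<Rightarrow> nat \<Rightarrow> ('v \<Rightarrow> nat) \<Rightarrow> bool" where
  "star_coloring G k \<rho> \<longleftrightarrow> (\<forall>v\<in>verts G. \<rho> v \<in> {1..k}) \<and>
     (\<nexists>S. maximal_star G S \<and> monochromatic \<rho> S)"

definition list_assignment :: "'v graph \<Rightarrow> nat \<Rightarrow> ('v \<Rightarrow> nat set) \<Rightarrow> bool" where
  "list_assignment G k L \<longleftrightarrow> (\<forall>v\<in>verts G. finite (L v) \<and> card (L v) = k)"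

definition star_choosable :: "'v graph \<Rightarrow> nat \<Rightarrow> bool" where
  "star_choosable G k \<longleftrightarrow> (\<forall>L. list_assignment G k L \<longrightarrow>
     (\<exists>\<rho>. (\<forall>v\<in>verts G. \<rho> v \<in> L v) \<and> (\<nexists>S. maximal_star G S \<and> monochromatic \<rho> S)))"

text \<open>A netblock representation is a tree \<open>T\<close> with a weight function \<open>K\<close>, of which only
  the values on \<open>edges T\<close> matter. \<open>Inserted e i\<close> is the \<open>i\<close>-th vertex inserted at the
  edge \<open>e\<close>.\<close>

datatype 'v nbvertex = Original 'v | Inserted "'v set" nat

definition block :: "('v set \<Rightarrow> nat) \<Rightarrow> 'v set \<Rightarrow> 'v nbvertex set" where
  "block K e = {Inserted e i | i. i < K e}"

definition netblock :: "'v graph \<Rightarrow> ('v set \<Rightarrow> nat) \<Rightarrow> 'v nbvertex graph" where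
  "netblock T K =
     (Original ` verts T \<union> (\<Union>e\<in>edges T. block K e),
      {{Original v, Original w} | v w. {v, w} \<in> edges T} \<union>
      {{x, y} | x y e. e \<in> edges T \<and> x \<in> block K e \<and> y \<in> block K e \<and> x \<noteq> y} \<union>
      {{x, Original v} | x v e. e \<in> edges T \<and> x \<in> block K e \<and> v \<in> e})"

text \<open>One-vertex subtrees have no edges and are thus \<open>c\<close>-subtrees for every \<open>c\<close>.\<close>

definition csubtree :: "'v graph \<Rightarrow> ('v set \<Rightarrow> nat) \<Rightarrow> nat \<Rightarrow> 'v graph \<Rightarrow> bool" where
  "csubtree T K c S \<longleftrightarrow> tree S \<and> subgraph S T \<and> (\<forall>e\<in>edges S. K e = c)"

text \<open>Maximality is with respect to inclusion of subtrees. For subtrees with at least one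
  edge this is the same as inclusion of edge sets (\<open>maximal_csubtree_iff_edges\<close> below). A
  one-vertex subtree is maximal iff no edge of weight \<open>c\<close> is incident to its vertex;
  comparing its empty edge set alone would never make it maximal in a tree with an edge.\<close>

definition maximal_csubtree :: "'v graph \<Rightarrow> ('v set \<Rightarrow> nat) \<Rightarrow> nat \<Rightarrow> 'v graph \<Rightarrow> bool" where
  "maximal_csubtree T K c S \<longleftrightarrow> csubtree T K c S \<and>
     (\<nexists>S'. csubtree T K c S' \<and> S' \<noteq> S \<and> subgraph S S')"

definition exit_vertex :: "'v graph \<Rightarrow> ('v set \<Rightarrow> nat) \<Rightarrow> nat \<Rightarrow> 'v \<Rightarrow> bool" where
  "exit_vertex T K c v \<longleftrightarrow> v \<in> verts T \<and> (\<exists>w. {v, w} \<in> edges T \<and> K {v, w} < c)"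

lemma tree_verts_eq_Union_edges:
  assumes "tree S" and "edges S \<noteq> {}"
  shows "verts S = \<Union> (edges S)"
proof
  from assms have sg: "simple_graph S" and con: "connected_graph S"
    by (auto simp: tree_def)
  show "\<Union> (edges S) \<subseteq> verts S"
    using sg by (auto simp: simple_graph_def)
  show "verts S \<subseteq> \<Union> (edges S)"
  proof
    fix v assume v: "v \<in> verts S"
    obtain e where e: "e \<in> edges S" using assms(2) by blast
    then obtain x where x: "x \<in> e"
      using sg by (fastforce simp: simple_graph_def)
    show "v \<in> \<Union> (edges S)"
    proof (cases "v = x")
      case True
      then show ?thesis using e x by blast
    next
      case False
      have "x \<in> verts S" using sg e x by (auto simp: simple_graph_def)
      then have "(v, x) \<in> {(x, y). {x, y} \<in> edges S}\<^sup>*"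
        using con v by (auto simp: connected_graph_def)
      then obtain y where "{v, y} \<in> edges S"
        using False by (auto elim: converse_rtranclE)
      then show ?thesis by blast
    qed
  qed
qed

lemma maximal_csubtree_iff_edges:
  assumes "edges S \<noteq> {}"
  shows "maximal_csubtree T K c S \<longleftrightarrow> csubtree T K c S \<and>
           (\<nexists>S'. csubtree T K c S' \<and> S' \<noteq> S \<and> edges S \<subseteq> edges S')"
proof -
  have "subgraph S S' \<longleftrightarrow> edges S \<subseteq> edges S'"
    if "csubtree T K c S" and "csubtree T K c S'" for S'
  proof
    assume sub: "edges S \<subseteq> edges S'"
    with assms have "edges S' \<noteq> {}" by auto
    then have "verts S = \<Union> (edges S)" "verts S' = \<Union> (edges S')"
      using that assms by (auto simp: csubtree_def dest: tree_verts_eq_Union_edges)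
    then show "subgraph S S'"
      using sub unfolding subgraph_def by (metis Union_mono)
  qed (simp add: subgraph_def)
  then show ?thesis unfolding maximal_csubtree_def by blast
qed

end

theory Submission
  imports Defs
begin

text \<open>A coloring without monochromatic maximal stars makes every block \<open>B(vw)\<close> rainbow and gives every
  vertex \<open>v\<close> of the tree an edge \<open>vw\<close> such that the color of \<open>v\<close> occurs neither on \<open>B(vw)\<close> nor
  on \<open>w\<close> (up to an exception at leaves); conversely, these two properties suffice. With \<open>k\<close> colors,
  an edge of weight \<open>k\<close> can serve neither of its ends, an edge of weight \<open>k - 1\<close> at most one, and an
  edge of smaller weight both. A maximal \<open>(k - 1)\<close>-subtree without exit vertex has fewer edges than
  vertices, so some vertex of it is not served. If exit vertices exist, every other vertex is
  served by the first edge of a shortest path of edges of weight \<open>k - 1\<close> to an exit vertex; a tree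
  is 2-choosable, and each block can then be colored greedily from its lists.\<close>

section \<open>Simple graphs, and forests built leaf by leaf\<close>

lemma simple_graph_edgeD:
  assumes "simple_graph G" "{x, y} \<in> edges G"
  shows "x \<noteq> y" "x \<in> verts G" "y \<in> verts G"
  using assms by (auto simp: simple_graph_def card_insert_if split: if_splits)

lemma simple_graph_no_loop: "simple_graph G \<Longrightarrow> {x} \<notin> edges G"
  using simple_graph_edgeD(1)[of G x x] by auto

lemma simple_graph_edgeE:
  assumes "simple_graph G" "e \<in> edges G"
  obtains x y where "e = {x, y}" "x \<noteq> y"
  using assms by (auto simp: simple_graph_def card_2_iff)

lemma simple_graph_edge_at:
  assumes "simple_graph G" "e \<in> edges G" "v \<in> e"
  shows "\<exists>w. e = {v, w}"
proof -
  obtain x y where "e = {x, y}" using simple_graph_edgeE[OF assms(1,2)] .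
  then show ?thesis using assms(3) by (auto simp: insert_commute)
qed

text \<open>The first vertex of a longest path inside \<open>U\<close> is such a vertex: a second
  neighbor in \<open>U\<close> would either prolong the path or close a cycle.\<close>

lemma forest_has_leaf:
  assumes sg: "simple_graph G" and acyc: "\<nexists>p. is_cycle G p"
    and fin: "finite U" and ne: "U \<noteq> {}"
  shows "\<exists>v\<in>U. \<forall>w\<in>U. \<forall>w'\<in>U. {v, w} \<in> edges G \<longrightarrow> {v, w'} \<in> edges G \<longrightarrow> w = w'"
proof (rule ccontr)
  assume "\<not> ?thesis"
  then have two: "\<And>v. v \<in> U \<Longrightarrow> \<exists>w\<in>U. \<exists>w'\<in>U. {v, w} \<in> edges G \<and> {v, w'} \<in> edges G \<and> w \<noteq> w'"
    by blast
  define P where "P p \<longleftrightarrow> p \<noteq> [] \<and> distinct p \<and> set p \<subseteq> U \<and>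
    (\<forall>i. Suc i < length p \<longrightarrow> {p ! i, p ! Suc i} \<in> edges G)" for p
  obtain u where "u \<in> U" using ne by blast
  then have Pu: "P [u]" by (simp add: P_def)
  have "length p \<le> card U" if "P p" for p
    using that fin card_mono[of U "set p"] by (simp add: P_def distinct_card)
  then have "\<exists>p. P p \<and> (\<forall>q. P q \<longrightarrow> length q \<le> length p)"
    by (intro ex_has_greatest_nat[of P "[u]" length "Suc (card U)"])
      (auto simp: Pu less_Suc_eq_le)
  then obtain p where p: "P p" and max: "\<And>q. P q \<Longrightarrow> length q \<le> length p" by blast
  obtain v q where vq: "p = v # q" using p by (cases p) (auto simp: P_def)
  have "v \<in> U" using p vq by (simp add: P_def)
  \<comment> \<open>Of the two neighbors of \<open>v\<close>, one differs from the second vertex of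
    the path, if there is one.\<close>
  then obtain w where w: "w \<in> U" "{v, w} \<in> edges G" and w1: "q \<noteq> [] \<Longrightarrow> w \<noteq> hd q"
    using two by metis
  show False
  proof (cases "w \<in> set p")
    case False
    have "P (w # p)"
      using p w False vq by (auto simp: P_def nth_Cons insert_commute split: nat.splits)
    from max[OF this] show False by simp
  next
    case True
    then obtain j where j: "j < length p" "p ! j = w" by (auto simp: in_set_conv_nth)
    \<comment> \<open>The prefix of the path up to \<open>w\<close> is closed by the edge
      \<open>vw\<close>; excluding the indices 0 and 1 makes it long enough for a cycle.\<close>
    have "j \<noteq> 0" using j vq simple_graph_edgeD(1)[OF sg w(2)] by (cases j) auto
    moreover have "j \<noteq> 1" using j vq w1 by (cases q) auto
    ultimately have j2: "j \<ge> 2" by simp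
    have "is_cycle G (take (Suc j) p)"
      unfolding is_cycle_def
    proof (intro conjI allI impI)
      show "3 \<le> length (take (Suc j) p)" using j j2 by simp
      show "distinct (take (Suc j) p)" using p by (simp add: P_def)
      fix i assume i: "i < length (take (Suc j) p)"
      show "{take (Suc j) p ! i, take (Suc j) p ! (Suc i mod length (take (Suc j) p))} \<in> edges G"
      proof (cases "i = j")
        case True
        moreover have "p ! 0 = v" using vq by simp
        ultimately show ?thesis using j w by (simp add: insert_commute)
      next
        case False
        then show ?thesis using i j p by (simp add: P_def)
      qed
    qed
    then show False using acyc by blast
  qed
qed

text \<open>Induction by adding a vertex with at most one neighbor so far. It runs over vertex sets
  inside a fixed \<open>G\<close>, so no smaller graph has to be shown to be a forest.\<close>

lemma forest_induct:
  assumes sg: "simple_graph G" and acyc: "\<nexists>p. is_cycle G p"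
    and fin: "finite U"
    and empty: "P {}"
    and step: "\<And>v U. finite U \<Longrightarrow> v \<notin> U \<Longrightarrow> P U \<Longrightarrow>
      (\<And>w w'. w \<in> U \<Longrightarrow> w' \<in> U \<Longrightarrow> {v, w} \<in> edges G \<Longrightarrow> {v, w'} \<in> edges G \<Longrightarrow> w = w') \<Longrightarrow>
      P (insert v U)"
  shows "P U"
  using fin
proof (induction "card U" arbitrary: U)
  case 0
  then show ?case using empty by simp
next
  case (Suc n)
  then have "U \<noteq> {}" by auto
  then obtain v where v: "v \<in> U"
    and leaf: "\<forall>w\<in>U. \<forall>w'\<in>U. {v, w} \<in> edges G \<longrightarrow> {v, w'} \<in> edges G \<longrightarrow> w = w'"
    using forest_has_leaf[OF sg acyc Suc.prems] by blast
  have "P (U - {v})" using Suc v by simp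
  then have "P (insert v (U - {v}))"
    using Suc.prems leaf by (intro step) auto
  then show ?case using v by (simp add: insert_absorb)
qed

text \<open>Each added vertex has to avoid the color of at most one earlier neighbor, and its list
  offers two colors.\<close>

lemma forest_list_coloring:
  assumes sg: "simple_graph G" and acyc: "\<nexists>p. is_cycle G p"
    and two: "\<And>v. v \<in> verts G \<Longrightarrow> finite (L v) \<and> 2 \<le> card (L v)"
  shows "\<exists>\<rho>. (\<forall>v\<in>verts G. \<rho> v \<in> L v) \<and> (\<forall>v w. {v, w} \<in> edges G \<longrightarrow> \<rho> v \<noteq> \<rho> w)"
proof -
  have fin: "finite (verts G)" using sg by (simp add: simple_graph_def)
  have "verts G \<subseteq> verts G \<longrightarrow> (\<exists>\<rho>. (\<forall>v\<in>verts G. \<rho> v \<in> L v) \<and>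
      (\<forall>v\<in>verts G. \<forall>w\<in>verts G. {v, w} \<in> edges G \<longrightarrow> \<rho> v \<noteq> \<rho> w))"
  proof (rule forest_induct[OF sg acyc fin, where P = "\<lambda>U. U \<subseteq> verts G \<longrightarrow>
      (\<exists>\<rho>. (\<forall>v\<in>U. \<rho> v \<in> L v) \<and> (\<forall>v\<in>U. \<forall>w\<in>U. {v, w} \<in> edges G \<longrightarrow> \<rho> v \<noteq> \<rho> w))"],
      simp, intro impI)
    fix v U
    assume v: "v \<notin> U" and sub: "insert v U \<subseteq> verts G"
      and IH: "U \<subseteq> verts G \<longrightarrow>
        (\<exists>\<rho>. (\<forall>v\<in>U. \<rho> v \<in> L v) \<and> (\<forall>v\<in>U. \<forall>w\<in>U. {v, w} \<in> edges G \<longrightarrow> \<rho> v \<noteq> \<rho> w))"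
      and leaf: "\<And>w w'. w \<in> U \<Longrightarrow> w' \<in> U \<Longrightarrow> {v, w} \<in> edges G \<Longrightarrow> {v, w'} \<in> edges G \<Longrightarrow> w = w'"
    obtain \<rho> where \<rho>: "\<forall>v\<in>U. \<rho> v \<in> L v"
      "\<forall>v\<in>U. \<forall>w\<in>U. {v, w} \<in> edges G \<longrightarrow> \<rho> v \<noteq> \<rho> w"
      using IH sub by blast
    \<comment> \<open>If \<open>v\<close> has no neighbor in \<open>U\<close>, then \<open>w\<close>
      is arbitrary and avoiding its color does no harm.\<close>
    obtain w where w: "\<And>w'. w' \<in> U \<Longrightarrow> {v, w'} \<in> edges G \<Longrightarrow> w' = w" using leaf by metis
    have "\<not> L v \<subseteq> {\<rho> w}"
      using two[of v] sub card_mono[of "{\<rho> w}" "L v"] by auto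
    then obtain c where c: "c \<in> L v" "c \<noteq> \<rho> w" by blast
    note loop = simple_graph_no_loop[OF sg, of v]
    show "\<exists>\<rho>. (\<forall>x\<in>insert v U. \<rho> x \<in> L x) \<and>
        (\<forall>x\<in>insert v U. \<forall>y\<in>insert v U. {x, y} \<in> edges G \<longrightarrow> \<rho> x \<noteq> \<rho> y)"
    proof (intro exI[of _ "\<rho>(v := c)"] conjI ballI impI)
      fix x assume "x \<in> insert v U"
      then show "(\<rho>(v := c)) x \<in> L x" using \<rho> c by auto
    next
      fix x y assume xy: "x \<in> insert v U" "y \<in> insert v U" "{x, y} \<in> edges G"
      then have "{y, x} \<in> edges G" by (simp add: insert_commute)
      then show "(\<rho>(v := c)) x \<noteq> (\<rho>(v := c)) y"
        using xy \<rho>(2) c w[of x] w[of y] v loop by (cases "x = v"; cases "y = v") auto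
    qed
  qed
  then show ?thesis using simple_graph_edgeD(2,3)[OF sg] by (metis subset_refl)
qed

text \<open>A forest has fewer edges than vertices, so its vertices cannot be matched injectively to
  incident edges.\<close>

lemma forest_no_pointing:
  assumes sg: "simple_graph G" and acyc: "\<nexists>p. is_cycle G p"
    and fin: "finite U" and ne: "U \<noteq> {}"
    and h: "\<And>v. v \<in> U \<Longrightarrow> h v \<in> U \<and> {v, h v} \<in> edges G \<and> h (h v) \<noteq> v"
  shows False
proof -
  have "(\<forall>v\<in>U. h v \<in> U \<and> {v, h v} \<in> edges G \<and> h (h v) \<noteq> v) \<longrightarrow> U = {}"
  proof (rule forest_induct[OF sg acyc fin, where P = "\<lambda>U.
      (\<forall>v\<in>U. h v \<in> U \<and> {v, h v} \<in> edges G \<and> h (h v) \<noteq> v) \<longrightarrow> U = {}"], simp, intro impI)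
    fix v U
    assume v: "v \<notin> U"
      and IH: "(\<forall>v\<in>U. h v \<in> U \<and> {v, h v} \<in> edges G \<and> h (h v) \<noteq> v) \<longrightarrow> U = {}"
      and leaf: "\<And>w w'. w \<in> U \<Longrightarrow> w' \<in> U \<Longrightarrow> {v, w} \<in> edges G \<Longrightarrow> {v, w'} \<in> edges G \<Longrightarrow> w = w'"
      and h: "\<forall>x\<in>insert v U. h x \<in> insert v U \<and> {x, h x} \<in> edges G \<and> h (h x) \<noteq> x"
    have hv: "h v \<in> U" "{v, h v} \<in> edges G"
      using h simple_graph_edgeD(1)[OF sg, of v "h v"] by auto
    \<comment> \<open>Only \<open>h v\<close> could point to the leaf \<open>v\<close>, which is
      forbidden. So \<open>h\<close> maps \<open>U\<close> into itself, and the induction hypothesis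
      makes \<open>U\<close> empty although it contains \<open>h v\<close>.\<close>
    have "h u \<noteq> v" if u: "u \<in> U" for u
    proof
      assume "h u = v"
      then have "{v, u} \<in> edges G" using h u by (metis insertCI insert_commute)
      then have "u = h v" using leaf u hv by blast
      then show False using h \<open>h u = v\<close> by auto
    qed
    then have "U = {}" using IH h by blast
    then show "insert v U = {}" using hv by simp
  qed
  then show False using h ne by blast
qed

section \<open>Components of the edges of weight \<open>c\<close>\<close>

definition weight_rel :: "'v graph \<Rightarrow> ('v set \<Rightarrow> nat) \<Rightarrow> nat \<Rightarrow> ('v \<times> 'v) set" where
  "weight_rel T K c = {(x, y). {x, y} \<in> edges T \<and> K {x, y} = c}"

text \<open>For a vertex \<open>v\<close> of a tree this turns out to be the unique maximal
  \<open>c\<close>-subtree through \<open>v\<close>, possibly consisting of \<open>v\<close>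
  alone.\<close>

definition wcomponent :: "'v graph \<Rightarrow> ('v set \<Rightarrow> nat) \<Rightarrow> nat \<Rightarrow> 'v \<Rightarrow> 'v graph" where
  "wcomponent T K c v =
     ((weight_rel T K c)\<^sup>* `` {v}, {e \<in> edges T. K e = c \<and> e \<subseteq> (weight_rel T K c)\<^sup>* `` {v}})"

lemma sym_graph_rel: "sym {(x, y). {x, y} \<in> edges G}"
  by (auto simp: sym_def insert_commute)

lemma csubtree_wcomponent:
  assumes "tree T" "v \<in> verts T"
  shows "csubtree T K c (wcomponent T K c v)"
proof -
  let ?R = "weight_rel T K c" and ?C = "wcomponent T K c v"
  have sg: "simple_graph T" and acyc: "\<nexists>p. is_cycle T p"
    using assms by (auto simp: tree_def)
  have sub: "?R\<^sup>* `` {v} \<subseteq> verts T"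
  proof
    fix u assume "u \<in> ?R\<^sup>* `` {v}"
    then have "(v, u) \<in> ?R\<^sup>*" by simp
    then show "u \<in> verts T"
      by (induction) (use assms simple_graph_edgeD[OF sg] in \<open>auto simp: weight_rel_def\<close>)
  qed
  then have sgr: "subgraph ?C T" by (auto simp: subgraph_def wcomponent_def)
  have sgC: "simple_graph ?C"
    using sub sg finite_subset[OF sub] by (auto simp: simple_graph_def wcomponent_def)
  have acC: "\<nexists>p. is_cycle ?C p"
    using acyc sgr unfolding is_cycle_def subgraph_def by blast
  let ?E = "{(x, y). {x, y} \<in> edges ?C}"
  \<comment> \<open>A walk of weight-\<open>c\<close> edges from \<open>v\<close> never leaves the
    component, so it is a walk within \<open>?C\<close>.\<close>
  have reach: "(v, u) \<in> ?E\<^sup>*" if "(v, u) \<in> ?R\<^sup>*" for u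
    using that
  proof (induction)
    case (step y z)
    have "(v, z) \<in> ?R\<^sup>*" using step by simp
    with step have "(y, z) \<in> ?E" by (auto simp: wcomponent_def weight_rel_def)
    with step.IH show ?case by (rule rtrancl_into_rtrancl)
  qed simp
  have "connected_graph ?C"
    unfolding connected_graph_def
  proof (intro conjI ballI)
    show "verts ?C \<noteq> {}" by (auto simp: wcomponent_def)
    fix x y assume "x \<in> verts ?C" "y \<in> verts ?C"
    then have "(v, x) \<in> ?E\<^sup>*" "(v, y) \<in> ?E\<^sup>*" using reach by (auto simp: wcomponent_def)
    moreover have "(x, v) \<in> ?E\<^sup>*"
      using symD[OF sym_rtrancl[OF sym_graph_rel]] calculation(1) .
    ultimately show "(x, y) \<in> ?E\<^sup>*" by (meson rtrancl_trans)
  qed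
  then show ?thesis using sgC acC sgr by (auto simp: csubtree_def tree_def wcomponent_def)
qed

text \<open>\<open>S\<close> is connected, so walks of weight-\<open>c\<close> edges lead from
  \<open>v\<close> to all its vertices.\<close>

lemma csubtree_subgraph_wcomponent:
  assumes S: "csubtree T K c S" and v: "v \<in> verts S"
  shows "subgraph S (wcomponent T K c v)"
proof -
  have "{(x, y). {x, y} \<in> edges S} \<subseteq> weight_rel T K c"
    using S by (auto simp: csubtree_def subgraph_def weight_rel_def)
  then have "{(x, y). {x, y} \<in> edges S}\<^sup>* \<subseteq> (weight_rel T K c)\<^sup>*" by (rule rtrancl_mono)
  then have V: "verts S \<subseteq> (weight_rel T K c)\<^sup>* `` {v}"
    using S v by (auto simp: csubtree_def tree_def connected_graph_def)
  have "e \<in> edges T \<and> K e = c \<and> e \<subseteq> verts S" if "e \<in> edges S" for e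
    using S that by (auto simp: csubtree_def subgraph_def tree_def simple_graph_def)
  then have "edges S \<subseteq> {e \<in> edges T. K e = c \<and> e \<subseteq> (weight_rel T K c)\<^sup>* `` {v}}"
    using V by (intro subsetI CollectI) (metis subset_trans)
  with V show ?thesis by (simp add: subgraph_def wcomponent_def)
qed

lemma subgraph_antisym: "subgraph G H \<Longrightarrow> subgraph H G \<Longrightarrow> G = H"
  by (auto simp: subgraph_def prod_eq_iff)

lemma maximal_csubtree_wcomponent:
  assumes "tree T" "v \<in> verts T"
  shows "maximal_csubtree T K c (wcomponent T K c v)"
proof -
  have "v \<in> verts (wcomponent T K c v)" by (simp add: wcomponent_def)
  then show ?thesis
    using csubtree_wcomponent[OF assms] csubtree_subgraph_wcomponent subgraph_antisym
    unfolding maximal_csubtree_def subgraph_def by (metis subsetD)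
qed

lemma maximal_csubtree_eq_wcomponent:
  assumes "tree T" "maximal_csubtree T K c S" "v \<in> verts S"
  shows "S = wcomponent T K c v"
proof -
  have "v \<in> verts T" using assms by (auto simp: maximal_csubtree_def csubtree_def subgraph_def)
  then show ?thesis
    using assms csubtree_wcomponent csubtree_subgraph_wcomponent
    unfolding maximal_csubtree_def by metis
qed

section \<open>Stars described by a center\<close>

text \<open>Replaces the isomorphism with \<open>K1 m\<close> by a center joined to a nonempty
  independent set of leaves. For a star with two vertices, either one may serve as the
  center.\<close>

lemma star_iff:
  assumes sg: "simple_graph G"
  shows "star G S \<longleftrightarrow> S \<subseteq> verts G \<and> (\<exists>c\<in>S. S \<noteq> {c} \<and> (\<forall>x\<in>S - {c}. {c, x} \<in> edges G) \<and>
    (\<forall>x\<in>S - {c}. \<forall>y\<in>S - {c}. {x, y} \<notin> edges G))" (is "_ \<longleftrightarrow> ?R")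
proof
  assume "star G S"
  then obtain m where S: "S \<subseteq> verts G" and m: "m \<ge> 1" and "isomorphic (induced G S) (K1 m)"
    by (auto simp: star_def)
  then obtain f where f: "bij_betw f S {0..m}"
    and E: "(\<lambda>e. f ` e) ` {e \<in> edges G. e \<subseteq> S} = {{0, i} | i. i \<in> {1..m}}"
    unfolding isomorphic_def induced_def K1_def fst_conv snd_conv by (elim exE conjE) (rule that)
  have inj: "inj_on f S" and im: "f ` S = {0..m}" using f by (auto simp: bij_betw_def)
  \<comment> \<open>Since \<open>f\<close> is injective on \<open>S\<close>, adjacency inside
    \<open>S\<close> can be read off from \<open>K1 m\<close>.\<close>
  have adj: "{x, y} \<in> edges G \<longleftrightarrow> {f x, f y} \<in> {{0, i} | i. i \<in> {1..m}}" if "x \<in> S" "y \<in> S" for x y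
  proof
    assume "{x, y} \<in> edges G"
    then have "f ` {x, y} \<in> (\<lambda>e. f ` e) ` {e \<in> edges G. e \<subseteq> S}" using that by blast
    then show "{f x, f y} \<in> {{0, i} | i. i \<in> {1..m}}" unfolding E by simp
  next
    assume "{f x, f y} \<in> {{0, i} | i. i \<in> {1..m}}"
    then obtain e where e: "e \<in> edges G" "e \<subseteq> S" "f ` {x, y} = f ` e"
      unfolding E[symmetric] by auto
    then have "{x, y} = e" using inj_on_image_eq_iff[OF inj, of "{x, y}" e] that by simp
    then show "{x, y} \<in> edges G" using e by simp
  qed
  have "0 \<in> f ` S" "1 \<in> f ` S" using im m by auto
  then obtain c d where c: "c \<in> S" "f c = 0" and d: "d \<in> S" "f d = 1" by (metis imageE)
  have pos: "f x \<in> {1..m}" if "x \<in> S - {c}" for x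
  proof -
    have "f x \<in> {0..m}" using that im by blast
    moreover have "f x \<noteq> f c" using inj_on_eq_iff[OF inj, of x c] that c by simp
    ultimately show ?thesis using c by simp
  qed
  show ?R
  proof (intro conjI S bexI[of _ c] ballI)
    show "c \<in> S" "S \<noteq> {c}" using c d by auto
  next
    fix x assume "x \<in> S - {c}"
    then show "{c, x} \<in> edges G" using adj[of c x] c pos[of x] by auto
  next
    fix x y assume "x \<in> S - {c}" "y \<in> S - {c}"
    then show "{x, y} \<notin> edges G"
      using adj[of x y] pos[of x] pos[of y] by (auto simp: doubleton_eq_iff)
  qed
next
  assume ?R
  then obtain c where S: "S \<subseteq> verts G" and c: "c \<in> S" "S \<noteq> {c}"
    and adj: "\<forall>x\<in>S - {c}. {c, x} \<in> edges G"
    and nadj: "\<forall>x\<in>S - {c}. \<forall>y\<in>S - {c}. {x, y} \<notin> edges G" by blast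
  have fin: "finite S" using S sg finite_subset by (auto simp: simple_graph_def)
  define m where "m = card (S - {c})"
  have "S - {c} \<noteq> {}" using c by blast
  then have m: "m \<ge> 1" using fin by (simp add: m_def Suc_le_eq card_gt_0_iff)
  have "\<exists>g. bij_betw g (S - {c}) {1..m}"
    using fin by (intro finite_same_card_bij) (simp_all add: m_def)
  then obtain g where g: "bij_betw g (S - {c}) {1..m}" ..
  define f where "f = g(c := 0)"
  have gf: "bij_betw f (S - {c}) {1..m}"
    using g by (rule bij_betw_cong[THEN iffD1, rotated]) (simp add: f_def)
  have "bij_betw f {c} {0}" by (simp add: f_def)
  then have "bij_betw f ({c} \<union> (S - {c})) ({0} \<union> {1..m})"
    using gf by (rule bij_betw_combine) simp
  moreover have "{c} \<union> (S - {c}) = S" "{0} \<union> {1..m} = {0..m}" using c by auto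
  ultimately have bf: "bij_betw f S {0..m}" by simp
  have edges: "{e \<in> edges G. e \<subseteq> S} = (\<lambda>x. {c, x}) ` (S - {c})"
  proof (intro equalityI subsetI)
    fix e assume "e \<in> {e \<in> edges G. e \<subseteq> S}"
    then have e: "e \<in> edges G" "e \<subseteq> S" by auto
    obtain x y where xy: "e = {x, y}" "x \<noteq> y" using simple_graph_edgeE[OF sg e(1)] .
    then have "x = c \<or> y = c" using e nadj by auto
    then show "e \<in> (\<lambda>x. {c, x}) ` (S - {c})" using xy e by auto
  qed (use adj c in auto)
  have "(\<lambda>e. f ` e) ` {e \<in> edges G. e \<subseteq> S} = (\<lambda>i. {0, i}) ` f ` (S - {c})"
    unfolding edges image_image by (auto simp: f_def)
  also have "\<dots> = {{0, i} | i. i \<in> {1..m}}" using gf by (auto simp: bij_betw_def)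
  finally show "star G S"
    using bf m S unfolding star_def isomorphic_def induced_def K1_def by auto
qed

section \<open>Adjacency in the netblock graph\<close>

lemma netblock_verts [simp]:
  "Original v \<in> verts (netblock T K) \<longleftrightarrow> v \<in> verts T"
  "Inserted e i \<in> verts (netblock T K) \<longleftrightarrow> e \<in> edges T \<and> i < K e"
  by (auto simp: netblock_def block_def)

lemma netblock_adj [simp]:
  "{Original v, Original w} \<in> edges (netblock T K) \<longleftrightarrow> {v, w} \<in> edges T"
  "{Inserted e i, Original v} \<in> edges (netblock T K) \<longleftrightarrow> e \<in> edges T \<and> i < K e \<and> v \<in> e"
  "{Original v, Inserted e i} \<in> edges (netblock T K) \<longleftrightarrow> e \<in> edges T \<and> i < K e \<and> v \<in> e"
  "{Inserted e i, Inserted f j} \<in> edges (netblock T K) \<longleftrightarrow>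
     e = f \<and> e \<in> edges T \<and> i < K e \<and> j < K e \<and> i \<noteq> j"
  by (auto simp: netblock_def block_def doubleton_eq_iff insert_commute)

lemma simple_graph_netblock:
  assumes "simple_graph T"
  shows "simple_graph (netblock T K)"
proof -
  have "finite (edges T)"
    using assms finite_subset[of "edges T" "Pow (verts T)"] by (auto simp: simple_graph_def)
  moreover have "finite (block K e)" for e
    using finite_imageI[of "{..<K e}" "Inserted e"] by (simp add: block_def setcompr_eq_image lessThan_def)
  ultimately have "finite (verts (netblock T K))"
    using assms by (simp add: netblock_def simple_graph_def)
  moreover have "e \<subseteq> verts (netblock T K) \<and> card e = 2" if e: "e \<in> edges (netblock T K)" for e
  proof -
    obtain x y where xy: "e = {x, y}" using e by (auto simp: netblock_def)
    have "x \<noteq> y \<and> x \<in> verts (netblock T K) \<and> y \<in> verts (netblock T K)"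
      using e simple_graph_edgeD[OF assms] assms unfolding xy
      by (cases x; cases y) (auto simp: simple_graph_def)
    then show ?thesis using xy by simp
  qed
  ultimately show ?thesis by (simp add: simple_graph_def)
qed

lemma tree_no_triangle:
  assumes "tree T" "{u, v} \<in> edges T" "{v, w} \<in> edges T" "{w, u} \<in> edges T"
  shows False
proof -
  have sg: "simple_graph T" using assms by (simp add: tree_def)
  have "u \<noteq> v" "v \<noteq> w" "w \<noteq> u"
    using assms(2-4)[THEN simple_graph_edgeD(1)[OF sg]] .
  then have "is_cycle T [u, v, w]"
    using assms(2-4) by (simp add: is_cycle_def All_less_Suc)
  then show False using assms by (auto simp: tree_def)
qed

text \<open>The neighbors of an inserted vertex are the rest of its block and the two ends of its
  edge, which form a clique. Hence a star centered at an inserted vertex has only two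
  vertices.\<close>

lemma netblock_inserted_nbrs:
  assumes "simple_graph T" "{Inserted e i, x} \<in> edges (netblock T K)"
    "{Inserted e i, y} \<in> edges (netblock T K)" "x \<noteq> y"
  shows "{x, y} \<in> edges (netblock T K)"
proof -
  have "{v, w} = e" if "v \<in> e" "w \<in> e" "v \<noteq> w" "e \<in> edges T" for v w
    using that by (elim simple_graph_edgeE[OF assms(1)]) auto
  then show ?thesis using assms by (cases x; cases y) auto
qed

text \<open>The cliques \<open>side K v w = B(vw) \<union> {w}\<close> partition the neighbours of \<open>v\<close>, so a star centred at
  \<open>v\<close> takes at most one vertex from each of them.\<close>

definition side :: "('v set \<Rightarrow> nat) \<Rightarrow> 'v \<Rightarrow> 'v \<Rightarrow> 'v nbvertex set" where
  "side K v w = insert (Original w) (block K {v, w})"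

lemma netblock_adj_side:
  assumes "simple_graph T"
  shows "{Original v, x} \<in> edges (netblock T K) \<longleftrightarrow> (\<exists>w. {v, w} \<in> edges T \<and> x \<in> side K v w)"
proof (cases x)
  case (Inserted e i)
  have "e \<in> edges T \<and> v \<in> e \<longleftrightarrow> (\<exists>w. {v, w} \<in> edges T \<and> e = {v, w})"
    using simple_graph_edge_at[OF assms, of e v] by auto
  then show ?thesis by (auto simp: Inserted side_def block_def)
qed (simp add: side_def block_def)

text \<open>An edge between different sides could only join \<open>w\<close> to \<open>w'\<close>,
  which would give a triangle in \<open>T\<close>.\<close>

lemma side_adj:
  assumes T: "tree T" and "{v, w} \<in> edges T" "{v, w'} \<in> edges T"
    "x \<in> side K v w" "y \<in> side K v w'"
  shows "{x, y} \<in> edges (netblock T K) \<longleftrightarrow> w = w' \<and> x \<noteq> y"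
proof -
  have sg: "simple_graph T" using T by (simp add: tree_def)
  note ne = simple_graph_edgeD(1)[OF sg]
  have "{w, w'} \<notin> edges T"
    using tree_no_triangle[OF T, of v w w'] assms by (auto simp: insert_commute)
  then show ?thesis
    using assms ne[of v w] ne[of v w'] simple_graph_no_loop[OF simple_graph_netblock[OF sg, of K]]
    by (auto simp: side_def block_def doubleton_eq_iff)
qed

section \<open>A sufficient condition for having no monochromatic maximal star\<close>

text \<open>A monochromatic star centered at \<open>v\<close> misses the whole side
  \<open>K v w\<close> that avoids the color of \<open>v\<close>, so it can be enlarged by
  \<open>w\<close> and is not maximal.\<close>

lemma helped_no_monochromatic_star:
  assumes T: "tree T"
    and blk: "\<And>e. e \<in> edges T \<Longrightarrow> inj_on (\<lambda>i. \<rho> (Inserted e i)) {..<K e}"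
    and helped: "\<And>v. v \<in> verts T \<Longrightarrow>
      \<exists>w. {v, w} \<in> edges T \<and> (\<forall>x\<in>side K v w. \<rho> x \<noteq> \<rho> (Original v))"
    and max: "maximal_star (netblock T K) S" and mono: "monochromatic \<rho> S"
  shows False
proof -
  let ?G = "netblock T K"
  have sg: "simple_graph T" using T by (simp add: tree_def)
  have sgG: "simple_graph ?G" using simple_graph_netblock[OF sg] .
  note star = star_iff[OF sgG]
  have S: "S \<subseteq> verts ?G" using max by (simp add: maximal_star_def star)
  have eq: "\<rho> x = \<rho> y" if "x \<in> S" "y \<in> S" for x y
    using mono that by (auto simp: monochromatic_def)
  \<comment> \<open>The center may be taken in \<open>T\<close>: a star centered at an inserted
    vertex is a pair, whose other vertex either is original and can be the center, or lies in the
    same block and has another color.\<close>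
  have "\<exists>v. Original v \<in> S \<and> (\<forall>x\<in>S - {Original v}. {Original v, x} \<in> edges ?G) \<and>
    (\<forall>x\<in>S - {Original v}. \<forall>y\<in>S - {Original v}. {x, y} \<notin> edges ?G)"
  proof -
    obtain c where c: "c \<in> S" "S \<noteq> {c}" "\<forall>x\<in>S - {c}. {c, x} \<in> edges ?G"
      "\<forall>x\<in>S - {c}. \<forall>y\<in>S - {c}. {x, y} \<notin> edges ?G"
      using max by (auto simp: maximal_star_def star)
    show ?thesis
    proof (cases c)
      case (Original v)
      then show ?thesis using c by blast
    next
      case (Inserted e i)
      obtain x where x: "x \<in> S - {c}" using c by blast
      have "y = x" if "y \<in> S - {c}" for y
        using netblock_inserted_nbrs[OF sg, of e i x K y] c x that Inserted by blast
      then have Sx: "S = {c, x}" using x c by blast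
      have cx: "{c, x} \<in> edges ?G" using c x by blast
      show ?thesis
      proof (cases x)
        case (Original v)
        show ?thesis using Sx cx Original simple_graph_no_loop[OF sgG]
          by (intro exI[of _ v]) (auto simp: insert_commute)
      next
        case I: (Inserted f j)
        then have "f = e" "e \<in> edges T" "i < K e" "j < K e" "i \<noteq> j"
          using cx Inserted by auto
        then have "\<rho> c \<noteq> \<rho> x" using blk[of e] Inserted I by (auto simp: inj_on_def)
        then show ?thesis using eq Sx by blast
      qed
    qed
  qed
  then obtain v where v: "Original v \<in> S" and adj: "\<forall>x\<in>S - {Original v}. {Original v, x} \<in> edges ?G"
    and nadj: "\<forall>x\<in>S - {Original v}. \<forall>y\<in>S - {Original v}. {x, y} \<notin> edges ?G" by blast
  have "v \<in> verts T" using S v by auto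
  then obtain w where w: "{v, w} \<in> edges T" and hw: "\<forall>x\<in>side K v w. \<rho> x \<noteq> \<rho> (Original v)"
    using helped by blast
  have disj: "S \<inter> side K v w = {}" using hw eq v by blast
  have ow: "Original w \<in> side K v w" by (simp add: side_def)
  have nw: "{x, Original w} \<notin> edges ?G" "{Original w, x} \<notin> edges ?G"
    if x: "x \<in> S - {Original v}" for x
  proof -
    obtain u where u: "{v, u} \<in> edges T" "x \<in> side K v u"
      using x adj netblock_adj_side[OF sg, of v x K] by blast
    then have "u \<noteq> w" using x disj by auto
    then show "{x, Original w} \<notin> edges ?G" using side_adj[OF T u(1) w u(2) ow] by simp
    then show "{Original w, x} \<notin> edges ?G" by (simp add: insert_commute)
  qed
  have vw: "v \<noteq> w" "w \<in> verts T" using simple_graph_edgeD[OF sg w] by auto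
  have "star ?G (insert (Original w) S)"
    unfolding star
  proof (intro conjI bexI[of _ "Original v"] ballI)
    show "insert (Original w) S \<subseteq> verts ?G" using S vw by simp
    show "insert (Original w) S \<noteq> {Original v}" using vw by auto
    fix x assume x: "x \<in> insert (Original w) S - {Original v}"
    then show "{Original v, x} \<in> edges ?G" using adj w by auto
    fix y assume y: "y \<in> insert (Original w) S - {Original v}"
    show "{x, y} \<notin> edges ?G" using x y nadj nw simple_graph_no_loop[OF sgG] by auto
  qed (use v in simp)
  moreover have "S \<subset> insert (Original w) S" using disj ow by blast
  ultimately show False using max by (auto simp: maximal_star_def)
qed


section \<open>Necessary conditions on a coloring\<close>

text \<open>By \<open>only\<close> and the clique property of inserted vertices, a third vertex
  adjacent to one of the pair is adjacent to both. Any larger star would then contain a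
  triangle.\<close>

lemma maximal_star_inserted_pair:
  assumes sg: "simple_graph T" and adj: "{Inserted e i, x} \<in> edges (netblock T K)"
    and only: "\<And>y. {x, y} \<in> edges (netblock T K) \<Longrightarrow> y \<noteq> Inserted e i \<Longrightarrow>
      {Inserted e i, y} \<in> edges (netblock T K)"
  shows "maximal_star (netblock T K) {Inserted e i, x}"
proof -
  let ?G = "netblock T K" and ?a = "Inserted e i"
  have sgG: "simple_graph ?G" using simple_graph_netblock[OF sg] .
  note star = star_iff[OF sgG]
  note aD = simple_graph_edgeD[OF sgG adj]
  note loop = simple_graph_no_loop[OF sgG]
  have st: "star ?G {?a, x}"
    unfolding star using aD adj loop by (intro conjI bexI[of _ ?a]) auto
  have "False" if S': "star ?G S'" and sub: "{?a, x} \<subset> S'" for S'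
  proof -
    obtain c where c: "c \<in> S'" "\<forall>x\<in>S' - {c}. {c, x} \<in> edges ?G"
      "\<forall>x\<in>S' - {c}. \<forall>y\<in>S' - {c}. {x, y} \<notin> edges ?G"
      using S' by (auto simp: star)
    obtain z where z: "z \<in> S'" "z \<noteq> ?a" "z \<noteq> x" using sub by blast
    have "c = ?a \<or> c = x" using c(3) sub adj by blast
    then show False
    proof
      assume ca: "c = ?a"
      then have "{x, z} \<in> edges ?G"
        using netblock_inserted_nbrs[OF sg adj, of z] c(2) z by blast
      then show False using c(3) ca z sub aD(1) by blast
    next
      assume cx: "c = x"
      then have "{?a, z} \<in> edges ?G" using only[of z] c(2) z by blast
      then show False using c(3) cx z sub aD(1) by blast
    qed
  qed
  then show ?thesis using st by (auto simp: maximal_star_def)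
qed

text \<open>Two vertices of a block share all their other neighbors, so they form a maximal
  star.\<close>

lemma star_coloring_block_inj:
  assumes sg: "simple_graph T"
    and good: "\<nexists>S. maximal_star (netblock T K) S \<and> monochromatic \<rho> S"
    and e: "e \<in> edges T"
  shows "inj_on (\<lambda>i. \<rho> (Inserted e i)) {..<K e}"
proof (rule inj_onI, rule ccontr)
  fix i j assume ij: "i \<in> {..<K e}" "j \<in> {..<K e}" "\<rho> (Inserted e i) = \<rho> (Inserted e j)" "i \<noteq> j"
  have "maximal_star (netblock T K) {Inserted e i, Inserted e j}"
  proof (rule maximal_star_inserted_pair[OF sg])
    fix y assume "{Inserted e j, y} \<in> edges (netblock T K)" "y \<noteq> Inserted e i"
    then show "{Inserted e i, y} \<in> edges (netblock T K)" using ij by (cases y) auto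
  qed (use ij e in simp)
  moreover have "monochromatic \<rho> {Inserted e i, Inserted e j}" using ij by (auto simp: monochromatic_def)
  ultimately show False using good by blast
qed

text \<open>The exceptional case arises because an edge of \<open>T\<close> at a leaf \<open>v\<close> is itself a maximal star
  only if both of its ends are leaves.\<close>

lemma star_coloring_helped:
  assumes T: "tree T" and ne: "edges T \<noteq> {}"
    and good: "\<nexists>S. maximal_star (netblock T K) S \<and> monochromatic \<rho> S"
    and v: "v \<in> verts T"
  shows "\<exists>w. {v, w} \<in> edges T \<and> (\<forall>x\<in>block K {v, w}. \<rho> x \<noteq> \<rho> (Original v)) \<and>
    (\<rho> (Original w) \<noteq> \<rho> (Original v) \<or>
     (\<forall>u. {v, u} \<in> edges T \<longrightarrow> u = w) \<and> (\<exists>u. {w, u} \<in> edges T \<and> u \<noteq> v))"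
proof (rule ccontr)
  assume no: "\<not> ?thesis"
  let ?G = "netblock T K" and ?v = "Original v"
  have sg: "simple_graph T" using T by (simp add: tree_def)
  have sgG: "simple_graph ?G" using simple_graph_netblock[OF sg] .
  note star = star_iff[OF sgG]
  note loop = simple_graph_no_loop[OF sgG]
  obtain e where "e \<in> edges T" "v \<in> e" using tree_verts_eq_Union_edges[OF T ne] v by auto
  then obtain w0 where w0: "{v, w0} \<in> edges T" using simple_graph_edge_at[OF sg] by metis
  show False
  proof (cases "\<forall>u. {v, u} \<in> edges T \<longrightarrow> u = w0")
    case leaf: True
    show False
    \<comment> \<open>The neighbors of the leaf \<open>v\<close> form the clique
      \<open>side K v w0\<close>, so \<open>v\<close> and any vertex of its only block form a
      maximal star.\<close>
    proof (cases "\<exists>x\<in>block K {v, w0}. \<rho> x = \<rho> ?v")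
      case True
      then obtain i where i: "i < K {v, w0}" "\<rho> (Inserted {v, w0} i) = \<rho> ?v"
        by (auto simp: block_def)
      have "maximal_star ?G {Inserted {v, w0} i, ?v}"
      proof (rule maximal_star_inserted_pair[OF sg])
        fix y assume "{?v, y} \<in> edges ?G" "y \<noteq> Inserted {v, w0} i"
        then obtain w where "{v, w} \<in> edges T" "y \<in> side K v w" "y \<noteq> Inserted {v, w0} i"
          using netblock_adj_side[OF sg, of v y K] by blast
        moreover have "w = w0" using leaf calculation by blast
        ultimately show "{Inserted {v, w0} i, y} \<in> edges ?G"
          using i by (auto simp: side_def block_def)
      qed (use i w0 in simp)
      moreover have "monochromatic \<rho> {Inserted {v, w0} i, ?v}" using i by (auto simp: monochromatic_def)
      ultimately show False using good by blast
    next
      case False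
      then have col: "\<rho> (Original w0) = \<rho> ?v" and leaf': "\<And>u. {w0, u} \<in> edges T \<Longrightarrow> u = v"
        using no w0 leaf by blast+
      note vw = simple_graph_edgeD[OF sg w0]
      \<comment> \<open>Both ends of the edge are leaves and share all other neighbors, so the edge
        itself is a maximal star.\<close>
      have st: "star ?G {?v, Original w0}"
        unfolding star using vw w0 loop by (intro conjI bexI[of _ ?v]) auto
      have "False" if S': "star ?G S'" and sub: "{?v, Original w0} \<subset> S'" for S'
      proof -
        obtain c where c: "c \<in> S'" "\<forall>x\<in>S' - {c}. {c, x} \<in> edges ?G"
          "\<forall>x\<in>S' - {c}. \<forall>y\<in>S' - {c}. {x, y} \<notin> edges ?G"
          using S' by (auto simp: star)
        obtain z where z: "z \<in> S'" "z \<noteq> ?v" "z \<noteq> Original w0" using sub by blast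
        have "{?v, Original w0} \<in> edges ?G" using w0 by simp
        then have cc: "c = ?v \<or> c = Original w0" using c(3) sub by blast
        have w0': "{w0, v} \<in> edges T" using w0 by (simp add: insert_commute)
        have "{?v, z} \<in> edges ?G \<longleftrightarrow> z \<in> side K v w0"
          unfolding netblock_adj_side[OF sg] using leaf w0 by blast
        moreover have "{Original w0, z} \<in> edges ?G \<longleftrightarrow> z \<in> side K w0 v"
          unfolding netblock_adj_side[OF sg] using leaf' w0' by blast
        moreover have "z \<in> side K v w0 \<longleftrightarrow> z \<in> side K w0 v"
          using z by (simp add: side_def insert_commute)
        ultimately have "{?v, z} \<in> edges ?G \<longleftrightarrow> {Original w0, z} \<in> edges ?G" by simp
        then have "{?v, z} \<in> edges ?G" "{Original w0, z} \<in> edges ?G"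
          using cc c(2) z by auto
        then show False using cc c(3) z sub vw(1) by blast
      qed
      then have "maximal_star ?G {?v, Original w0}" using st by (auto simp: maximal_star_def)
      moreover have "monochromatic \<rho> {?v, Original w0}" using col by (auto simp: monochromatic_def)
      ultimately show False using good by blast
    qed
  next
    case False
    then obtain w1 where w1: "{v, w1} \<in> edges T" "w1 \<noteq> w0" by blast
    have "\<exists>x\<in>side K v w. \<rho> x = \<rho> ?v" if "{v, w} \<in> edges T" for w
      using no that unfolding side_def by blast
    \<comment> \<open>If no edge serves \<open>v\<close>, every side of \<open>v\<close> contains a
      vertex of its color. One such vertex per side, together with \<open>v\<close>, gives a
      monochromatic star.\<close>
    then obtain f where f: "\<And>w. {v, w} \<in> edges T \<Longrightarrow> f w \<in> side K v w \<and> \<rho> (f w) = \<rho> ?v" by metis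
    define N where "N = {w. {v, w} \<in> edges T}"
    define S where "S = insert ?v (f ` N)"
    have fadj: "{?v, f w} \<in> edges ?G" if "w \<in> N" for w
      using netblock_adj_side[OF sg, of v "f w" K] f that by (auto simp: N_def)
    have ff: "{f w, f w'} \<in> edges ?G \<longleftrightarrow> w = w' \<and> f w \<noteq> f w'" if "w \<in> N" "w' \<in> N" for w w'
      using side_adj[OF T, of v w w' "f w" K "f w'"] f that by (simp add: N_def)
    have fv: "f w \<noteq> ?v" if "w \<in> N" for w
      using simple_graph_edgeD(1)[OF sgG fadj[OF that]] by simp
    have wN: "w0 \<in> N" "w1 \<in> N" using w0 w1 by (auto simp: N_def)
    have f01: "f w0 \<noteq> f w1"
      using f[OF w0] f[OF w1(1)] w1(2) simple_graph_edgeD(1)[OF sg w0]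
      by (auto simp: side_def block_def doubleton_eq_iff)
    have st: "star ?G S"
      unfolding star
    proof (intro conjI bexI[of _ ?v] ballI)
      show "S \<subseteq> verts ?G" using v simple_graph_edgeD(3)[OF sgG fadj] by (auto simp: S_def)
      show "S \<noteq> {?v}" using fv wN by (auto simp: S_def)
      show "?v \<in> S" by (simp add: S_def)
      fix x assume x: "x \<in> S - {?v}"
      then show "{?v, x} \<in> edges ?G" using fadj by (auto simp: S_def)
      fix y assume "y \<in> S - {?v}"
      then show "{x, y} \<notin> edges ?G" using x ff by (auto simp: S_def)
    qed
    have "False" if S': "star ?G S'" and sub: "S \<subset> S'" for S'
    proof -
      obtain c where c: "c \<in> S'" "\<forall>x\<in>S' - {c}. {c, x} \<in> edges ?G"
        "\<forall>x\<in>S' - {c}. \<forall>y\<in>S' - {c}. {x, y} \<notin> edges ?G"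
        using S' by (auto simp: star)
      have inS: "?v \<in> S'" "f w \<in> S'" if "w \<in> N" for w using sub that by (auto simp: S_def)
      \<comment> \<open>\<open>S\<close> has two distinct leaves, so a larger star must keep the
        center \<open>v\<close>.\<close>
      have cv: "c = ?v"
      proof (rule ccontr)
        assume "c \<noteq> ?v"
        then have "f w = c" if "w \<in> N" for w using c(3) fadj[OF that] inS[OF that] by blast
        then show False using f01 wN by simp
      qed
      obtain z where z: "z \<in> S'" "z \<notin> S" using sub by blast
      then have "z \<noteq> ?v" by (auto simp: S_def)
      then have "{?v, z} \<in> edges ?G" using z c cv by blast
      then obtain w where w: "{v, w} \<in> edges T" "z \<in> side K v w"
        using netblock_adj_side[OF sg, of v z K] by blast
      then have wN: "w \<in> N" by (simp add: N_def)
      then have "f w \<noteq> z" using z by (auto simp: S_def)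
      \<comment> \<open>A further leaf would share a side, which is a clique, with the
        representative \<open>f w\<close>.\<close>
      then have "{z, f w} \<in> edges ?G"
        using side_adj[OF T w(1) w(1) w(2), of "f w"] f[OF w(1)] by simp
      then show False using c(3) cv z \<open>z \<noteq> ?v\<close> inS[OF wN] fv[OF wN] by blast
    qed
    then have "maximal_star ?G S" using st by (auto simp: maximal_star_def)
    moreover have "monochromatic \<rho> S" using f by (auto simp: monochromatic_def S_def N_def)
    ultimately show False using good by blast
  qed
qed

section \<open>From a star coloring to exit vertices\<close>

lemma star_coloring_imp_exit_condition:
  assumes T: "tree T" and ne: "edges T \<noteq> {}"
    and col: "star_coloring (netblock T K) k \<rho>"
  shows "(\<forall>e\<in>edges T. K e \<le> k) \<and>
    (\<forall>S. maximal_csubtree T K (k - 1) S \<longrightarrow> (\<exists>v\<in>verts S. exit_vertex T K (k - 1) v))"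
proof -
  let ?G = "netblock T K"
  have sg: "simple_graph T" and acyc: "\<nexists>p. is_cycle T p" using T by (auto simp: tree_def)
  have rng: "\<And>x. x \<in> verts ?G \<Longrightarrow> \<rho> x \<in> {1..k}"
    and good: "\<nexists>S. maximal_star ?G S \<and> monochromatic \<rho> S"
    using col by (auto simp: star_coloring_def)
  note inj = star_coloring_block_inj[OF sg good]
  \<comment> \<open>The block of \<open>e\<close> shows \<open>K e\<close> distinct colors, all
    outside \<open>C\<close>.\<close>
  have cardC: "K e + card C \<le> k"
    if e: "e \<in> edges T" and C: "C \<subseteq> {1..k}" and avoid: "\<forall>x\<in>block K e. \<rho> x \<notin> C" for e C
  proof -
    let ?B = "(\<lambda>i. \<rho> (Inserted e i)) ` {..<K e}"
    have "?B \<inter> C = {}" using avoid by (auto simp: block_def)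
    moreover have sub: "?B \<union> C \<subseteq> {1..k}" using rng C e by fastforce
    moreover have "card ?B = K e" using card_image[OF inj[OF e]] by simp
    moreover have "finite C" using C finite_subset by blast
    ultimately show ?thesis
      using card_mono[OF _ sub] by (simp add: card_Un_disjoint)
  qed
  have le: "\<forall>e\<in>edges T. K e \<le> k" using cardC[of _ "{}"] by simp
  have "\<exists>v\<in>verts S. exit_vertex T K (k - 1) v" if S: "maximal_csubtree T K (k - 1) S" for S
  proof (rule ccontr)
    assume nex: "\<not> ?thesis"
    have ST: "subgraph S T" "tree S" using S by (auto simp: maximal_csubtree_def csubtree_def)
    have VS: "verts S \<subseteq> verts T" using ST by (simp add: subgraph_def)
    define Q where "Q v w \<longleftrightarrow> {v, w} \<in> edges T \<and> (\<forall>x\<in>block K {v, w}. \<rho> x \<noteq> \<rho> (Original v)) \<and>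
      (\<rho> (Original w) \<noteq> \<rho> (Original v) \<or>
       (\<forall>u. {v, u} \<in> edges T \<longrightarrow> u = w) \<and> (\<exists>u. {w, u} \<in> edges T \<and> u \<noteq> v))" for v w
    have "\<forall>v\<in>verts S. \<exists>w. Q v w"
      unfolding Q_def using star_coloring_helped[OF T ne good] VS by blast
    then obtain h where h: "\<And>v. v \<in> verts S \<Longrightarrow> Q v (h v)" by metis
    have step: "h v \<in> verts S \<and> {v, h v} \<in> edges T \<and> h (h v) \<noteq> v" if v: "v \<in> verts S" for v
    proof -
      let ?w = "h v"
      have q: "Q v ?w" using h[OF v] .
      then have vw: "{v, ?w} \<in> edges T" by (simp add: Q_def)
      have vT: "v \<in> verts T" "?w \<in> verts T" using simple_graph_edgeD[OF sg vw] by auto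
      have rv: "\<rho> (Original v) \<in> {1..k}" "\<rho> (Original ?w) \<in> {1..k}"
        using rng vT by simp_all
      \<comment> \<open>The color of \<open>v\<close> is missing on the block, so the weight is
        below \<open>k\<close>; as \<open>v\<close> is not an exit vertex, it is exactly
        \<open>k - 1\<close>. The count also gives \<open>k \<ge> 1\<close>, so the subtraction is
        not truncated.\<close>
      have "K {v, ?w} + card {\<rho> (Original v)} \<le> k"
        using q rv by (intro cardC[OF vw]) (auto simp: Q_def)
      moreover have "\<not> K {v, ?w} < k - 1" using nex v vw vT by (auto simp: exit_vertex_def)
      ultimately have wt: "K {v, ?w} = k - 1" and k: "k \<ge> 1" by auto
      have "?w \<in> verts S"
        using maximal_csubtree_eq_wcomponent[OF T S v] vw wt
        by (auto simp: wcomponent_def weight_rel_def)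
      moreover have "h ?w \<noteq> v"
      proof
        assume hw: "h ?w = v"
        then have q': "Q ?w v" using h[OF \<open>?w \<in> verts S\<close>] by simp
        \<comment> \<open>If the edge served both ends, its block would leave room for only one
          further color, so the ends would agree. Then the exceptional case holds for both, making
          \<open>v\<close> the only neighbor of \<open>?w\<close> and at the same time not the only
          one.\<close>
        have "K {v, ?w} + card {\<rho> (Original v), \<rho> (Original ?w)} \<le> k"
          using q q' rv by (intro cardC[OF vw]) (auto simp: Q_def insert_commute)
        then have "\<rho> (Original v) = \<rho> (Original ?w)"
          using wt k by (cases "\<rho> (Original v) = \<rho> (Original ?w)") auto
        then show False using q q' by (auto simp: Q_def)
      qed
      ultimately show ?thesis using vw by simp
    qed
    have "finite (verts S)" "verts S \<noteq> {}"
      using ST by (auto simp: tree_def simple_graph_def connected_graph_def)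
    then show False using forest_no_pointing[OF sg acyc] step by blast
  qed
  then show ?thesis using le by blast
qed

section \<open>From exit vertices to list colorings\<close>

text \<open>Values are chosen one after another; at each index fewer than \<open>n\<close> values
  are already taken.\<close>

lemma greedy_distinct_representatives:
  fixes n :: nat
  assumes "\<And>i. i < n \<Longrightarrow> finite (M i) \<and> n \<le> card (M i)"
  shows "\<exists>f. inj_on f {..<n} \<and> (\<forall>i<n. f i \<in> M i)"
proof -
  have "m \<le> n \<Longrightarrow> \<exists>f. inj_on f {..<m} \<and> (\<forall>i<m. f i \<in> M i)" for m
  proof (induction m)
    case (Suc m)
    then obtain f where f: "inj_on f {..<m}" "\<forall>i<m. f i \<in> M i" by auto
    have "card (f ` {..<m}) < card (M m)"
      using assms[of m] Suc.prems card_image[OF f(1)] by simp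
    then have "\<not> M m \<subseteq> f ` {..<m}" using card_mono[of "f ` {..<m}" "M m"] by auto
    then obtain c where c: "c \<in> M m" "c \<notin> f ` {..<m}" by blast
    have "inj_on (f(m := c)) {..<Suc m}"
      using f(1) c(2) by (auto simp: inj_on_def less_Suc_eq)
    moreover have "\<forall>i<Suc m. (f(m := c)) i \<in> M i" using f(2) c(1) by (auto simp: less_Suc_eq)
    ultimately show ?case by blast
  qed simp
  then show ?thesis by blast
qed

text \<open>Non-exit vertices are sent one step closer to an exit vertex inside their component, so that
  no edge of weight \<open>c\<close> is used from both ends.\<close>

lemma exit_assignment:
  assumes T: "tree T"
    and ex: "\<And>S. maximal_csubtree T K c S \<Longrightarrow> \<exists>v\<in>verts S. exit_vertex T K c v"
  shows "\<exists>h. \<forall>v\<in>verts T. {v, h v} \<in> edges T \<and> K {v, h v} \<le> c \<and>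
    (K {v, h v} = c \<longrightarrow> h (h v) \<noteq> v)"
proof -
  let ?R = "weight_rel T K c"
  have sg: "simple_graph T" using T by (simp add: tree_def)
  \<comment> \<open>The distance from \<open>v\<close> to the nearest exit vertex along edges of
    weight \<open>c\<close>.\<close>
  define d where "d v = (LEAST n. \<exists>x. exit_vertex T K c x \<and> (v, x) \<in> ?R ^^ n)" for v
  have reach: "\<exists>n x. exit_vertex T K c x \<and> (v, x) \<in> ?R ^^ n" if v: "v \<in> verts T" for v
  proof -
    obtain x where "x \<in> verts (wcomponent T K c v)" "exit_vertex T K c x"
      using ex[OF maximal_csubtree_wcomponent[OF T v]] by blast
    then show ?thesis by (auto simp: wcomponent_def rtrancl_power)
  qed
  have "\<exists>w. {v, w} \<in> edges T \<and>
      (if exit_vertex T K c v then K {v, w} < c else K {v, w} = c \<and> d w < d v)"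
    if v: "v \<in> verts T" for v
  proof (cases "exit_vertex T K c v")
    case True
    then show ?thesis by (auto simp: exit_vertex_def)
  next
    case False
    obtain x where x: "exit_vertex T K c x" "(v, x) \<in> ?R ^^ d v"
      using LeastI_ex[OF reach[OF v]] unfolding d_def by blast
    then obtain n where n: "d v = Suc n" using False by (cases "d v") auto
    then obtain w where w: "(v, w) \<in> ?R" "(w, x) \<in> ?R ^^ n"
      using x by (metis relpow_Suc_D2)
    have "d w \<le> n" unfolding d_def by (rule Least_le) (use x w in blast)
    then show ?thesis using False w n by (auto simp: weight_rel_def)
  qed
  then obtain h where h: "\<And>v. v \<in> verts T \<Longrightarrow> {v, h v} \<in> edges T \<and>
      (if exit_vertex T K c v then K {v, h v} < c else K {v, h v} = c \<and> d (h v) < d v)"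
    by metis
  \<comment> \<open>An edge of weight \<open>c\<close> is chosen only at a non-exit vertex, where it
    decreases \<open>d\<close>; it cannot decrease \<open>d\<close> in both directions.\<close>
  have "h (h v) \<noteq> v" if v: "v \<in> verts T" and "K {v, h v} = c" for v
  proof
    assume eq: "h (h v) = v"
    have hv: "h v \<in> verts T" using h[OF v] simple_graph_edgeD[OF sg] by blast
    have "d (h v) < d v" using h[OF v] that by (auto split: if_splits)
    moreover have "K {h v, h (h v)} = c" using that eq by (simp add: insert_commute)
    then have "d v < d (h v)" using h[OF hv] eq by (auto split: if_splits)
    ultimately show False by simp
  qed
  then show ?thesis using h by (metis less_imp_le order_refl)
qed

text \<open>The tree is colored properly from its lists first. Each block then avoids the colors of
  the ends that its edge serves, and \<open>h\<close> keeps the number of these ends at most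
  \<open>k - K e\<close>.\<close>

lemma exit_condition_imp_star_choosable:
  assumes T: "tree T"
    and le: "\<And>e. e \<in> edges T \<Longrightarrow> K e \<le> k"
    and ex: "\<And>S. maximal_csubtree T K (k - 1) S \<Longrightarrow> \<exists>v\<in>verts S. exit_vertex T K (k - 1) v"
  shows "star_choosable (netblock T K) k"
  unfolding star_choosable_def
proof (intro allI impI)
  fix L assume L: "list_assignment (netblock T K) k L"
  have sg: "simple_graph T" and acyc: "\<nexists>p. is_cycle T p" using T by (auto simp: tree_def)
  obtain v0 where v0: "v0 \<in> verts T" using T by (auto simp: tree_def connected_graph_def)
  have "\<exists>v. exit_vertex T K (k - 1) v" using ex[OF maximal_csubtree_wcomponent[OF T v0]] by blast
  \<comment> \<open>Some edge has weight below \<open>k - 1\<close>, so \<open>k - 1\<close> is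
    positive. This gives the tree the lists of size two that it needs.\<close>
  then have k: "k \<ge> 2" by (auto simp: exit_vertex_def)
  have cardL: "finite (L x)" "card (L x) = k" if "x \<in> verts (netblock T K)" for x
    using L that by (auto simp: list_assignment_def)
  obtain \<sigma> where \<sigma>: "\<And>v. v \<in> verts T \<Longrightarrow> \<sigma> v \<in> L (Original v)"
    and proper: "\<And>v w. {v, w} \<in> edges T \<Longrightarrow> \<sigma> v \<noteq> \<sigma> w"
    using forest_list_coloring[OF sg acyc, of "\<lambda>v. L (Original v)"] cardL k by auto
  obtain h where h: "\<And>v. v \<in> verts T \<Longrightarrow> {v, h v} \<in> edges T"
    and hc: "\<And>v. v \<in> verts T \<Longrightarrow> K {v, h v} \<le> k - 1"
    and hh: "\<And>v. v \<in> verts T \<Longrightarrow> K {v, h v} = k - 1 \<Longrightarrow> h (h v) \<noteq> v"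
    using exit_assignment[OF T ex] by metis
  \<comment> \<open>The colors forbidden on the block of \<open>e\<close>: those of the vertices
    that chose \<open>e\<close>.\<close>
  define F where "F e = \<sigma> ` {v \<in> verts T. {v, h v} = e}" for e
  have cardF: "finite (F e) \<and> K e + card (F e) \<le> k" if e: "e \<in> edges T" for e
  proof -
    let ?A = "{v \<in> verts T. {v, h v} = e}"
    obtain x y where xy: "e = {x, y}" "x \<noteq> y" using simple_graph_edgeE[OF sg e] .
    have A: "?A \<subseteq> {x, y}" using xy by auto
    then have finA: "finite ?A" using finite_subset by blast
    have cF: "card (F e) \<le> card ?A" unfolding F_def using finA by (rule card_image_le)
    have "card ?A \<le> 2" using card_mono[OF _ A] xy by simp
    \<comment> \<open>An edge of weight \<open>k\<close> is never chosen, one of weight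
      \<open>k - 1\<close> at most once, and a lighter one at most twice.\<close>
    moreover have "card ?A = 0" if "K e = k"
    proof -
      have "?A = {}" using hc that k by fastforce
      then show ?thesis by (simp only: card.empty)
    qed
    moreover have "card ?A \<le> 1" if Ke: "K e = k - 1"
    proof -
      have "\<not> (x \<in> ?A \<and> y \<in> ?A)"
      proof
        assume a: "x \<in> ?A \<and> y \<in> ?A"
        then have "h x = y" "h y = x" using xy by (auto simp: doubleton_eq_iff)
        then show False using hh[of x] a Ke xy by auto
      qed
      then have "?A \<subseteq> {x} \<or> ?A \<subseteq> {y}" using A by blast
      then show ?thesis using card_mono[of "{x}" ?A] card_mono[of "{y}" ?A] by auto
    qed
    ultimately have "K e + card ?A \<le> k" using le[OF e] k by (cases "K e = k"; cases "K e = k - 1") auto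
    then show ?thesis using cF finA by (simp add: F_def)
  qed
  have "\<exists>f. inj_on f {..<K e} \<and> (\<forall>i<K e. f i \<in> L (Inserted e i) - F e)" if e: "e \<in> edges T" for e
  proof (rule greedy_distinct_representatives)
    fix i assume i: "i < K e"
    have "card (L (Inserted e i)) - card (F e) \<le> card (L (Inserted e i) - F e)"
      using cardF[OF e] by (intro diff_card_le_card_Diff) simp
    then show "finite (L (Inserted e i) - F e) \<and> K e \<le> card (L (Inserted e i) - F e)"
      using cardL[of "Inserted e i"] cardF[OF e] e i by auto
  qed
  then obtain \<tau> where inj: "\<And>e. e \<in> edges T \<Longrightarrow> inj_on (\<tau> e) {..<K e}"
    and \<tau>: "\<And>e i. e \<in> edges T \<Longrightarrow> i < K e \<Longrightarrow> \<tau> e i \<in> L (Inserted e i) - F e"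
    by metis
  define \<rho> where "\<rho> x = (case x of Original v \<Rightarrow> \<sigma> v | Inserted e i \<Rightarrow> \<tau> e i)" for x
  have "\<rho> x \<in> L x" if "x \<in> verts (netblock T K)" for x
    using that \<sigma> \<tau> by (cases x) (auto simp: \<rho>_def)
  moreover have "\<not> (maximal_star (netblock T K) S \<and> monochromatic \<rho> S)" for S
  proof
    assume S: "maximal_star (netblock T K) S \<and> monochromatic \<rho> S"
    show False
    proof (rule helped_no_monochromatic_star[OF T])
      show "inj_on (\<lambda>i. \<rho> (Inserted e i)) {..<K e}" if "e \<in> edges T" for e
        using inj[OF that] by (simp add: \<rho>_def)
      show "\<exists>w. {v, w} \<in> edges T \<and> (\<forall>x\<in>side K v w. \<rho> x \<noteq> \<rho> (Original v))" if v: "v \<in> verts T" for v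
      proof (intro exI[of _ "h v"] conjI ballI)
        show vh: "{v, h v} \<in> edges T" using h[OF v] .
        have vF: "\<sigma> v \<in> F {v, h v}" using v by (auto simp: F_def)
        have "\<tau> {v, h v} i \<noteq> \<sigma> v" if "i < K {v, h v}" for i using \<tau>[OF vh that] vF by auto
        moreover fix x assume "x \<in> side K v (h v)"
        ultimately show "\<rho> x \<noteq> \<rho> (Original v)"
          using proper[OF vh] by (auto simp: side_def block_def \<rho>_def)
      qed
    qed (use S in auto)
  qed
  ultimately show "\<exists>\<rho>. (\<forall>v\<in>verts (netblock T K). \<rho> v \<in> L v) \<and>
      (\<nexists>S. maximal_star (netblock T K) S \<and> monochromatic \<rho> S)" by blast
qed

section \<open>Constant lists and the cycle of implications\<close>

lemma star_choosable_imp_star_coloring: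
  assumes "star_choosable G k"
  shows "\<exists>\<rho>. star_coloring G k \<rho>"
proof -
  have "list_assignment G k (\<lambda>_. {1..k})" by (simp add: list_assignment_def)
  then show ?thesis using assms unfolding star_choosable_def star_coloring_def by blast
qed

theorem theorem44:
  fixes T :: "'v graph" and K :: "'v set \<Rightarrow> nat" and k :: nat
  assumes "tree T"
    and "edges T \<noteq> {}"
  shows "(star_choosable (netblock T K) k \<longleftrightarrow> (\<exists>\<rho>. star_coloring (netblock T K) k \<rho>)) \<and>
         ((\<exists>\<rho>. star_coloring (netblock T K) k \<rho>) \<longleftrightarrow>
            (\<forall>e\<in>edges T. K e \<le> k) \<and>
            (\<forall>S. maximal_csubtree T K (k - 1) S \<longrightarrow>
               (\<exists>v\<in>verts S. exit_vertex T K (k - 1) v)))"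
  using star_choosable_imp_star_coloring[of "netblock T K" k]
    star_coloring_imp_exit_condition[OF assms, of K k]
    exit_condition_imp_star_choosable[OF assms(1), of K k]
  by blast

end
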